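(* Let $(M_n)_{n\in\mathbb{N}}\in\{C_1,C_2\}^{\mathbb{N}}$ and let $\mathbf{f}\in\Delta$ be such that $\bigcap_{n\in\mathbb{N}}M_{[0,n)}\mathbb{R}^3_{\ge0}=\mathbb{R}_{\ge0}\mathbf{f}$. (i) $\dim_{\mathbb{Q}}(\mathbf{f})=1$ if and only if $(M_n)_{n\in\mathbb{N}}\in\{C_1,C_2\}^*\{C_1^{\mathbb{N}},C_2^{\mathbb{N}}\}$. (ii) $\dim_{\mathbb{Q}}(\mathbf{f})=2$ if and only if $(M_n)_{n\in\mathbb{N}}\in\left(\{C_1,C_2\}^*\{C_1^2,C_2^2\}^{\mathbb{N}}\right)\setminus\{C_1,C_2\}^*\{C_1^{\mathbb{N}},C_2^{\mathbb{N}}\}$. (iii) $\dim_{\mathbb{Q}}(\mathbf{f})=3$ if and only if $(M_n)_{n\in\mathbb{N}}$ is primitive.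
   Context: $C_1=\begin{pmatrix}1&1&0\\0&0&1\\0&1&0\end{pmatrix}$, $C_2=\begin{pmatrix}0&1&0\\1&0&0\\0&1&1\end{pmatrix}$, $\Delta=\{\mathbf{x}\in\mathbb{R}^3_{\ge0}\mid\|\mathbf{x}\|_1=1\}$, $M_{[0,n)}=M_0M_1\cdots M_{n-1}$. For $\mathbf{f}\in\mathbb{R}^3$, $\dim_{\mathbb{Q}}(\mathbf{f})$ is the dimension of the $\mathbb{Q}$-vector space spanned by the entries of $\mathbf{f}$. Sequences of matrices are regarded as infinite words over $\{C_1,C_2\}$: $\{C_1,C_2\}^*\{C_1^{\mathbb{N}},C_2^{\mathbb{N}}\}$ is the set of eventually constant sequences; $\{C_1,C_2\}^*\{C_1^2,C_2^2\}^{\mathbb{N}}$ is the set of sequences for which there is $N\ge0$ with $M_{N+2i}=M_{N+2i+1}$ for all $i\in\mathbb{N}$. A sequence $(M_n)_n$ of nonnegative square matrices is primitive if for all $r\in\mathbb{N}$ there is $s>r$ such that $M_rM_{r+1}\cdots M_{s-1}$ has only positive entries. *)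

theory Defs
  imports "HOL-Analysis.Analysis"
begin

definition C1 :: "real^3^3" where
  "C1 = vector [vector [1, 1, 0],
                vector [0, 0, 1],
                vector [0, 1, 0]]"

definition C2 :: "real^3^3" where
  "C2 = vector [vector [0, 1, 0],
                vector [1, 0, 0],
                vector [0, 1, 1]]"

definition nonneg_orthant :: "(real^'n) set" where
  "nonneg_orthant = {x. \<forall>i. 0 \<le> x $ i}"

definition Simplex :: "(real^3) set" where
  "Simplex = {x \<in> nonneg_orthant. (\<Sum>i\<in>UNIV. \<bar>x $ i\<bar>) = 1}"

definition ray :: "'a::real_vector \<Rightarrow> 'a set" where
  "ray f = (\<lambda>t. t *\<^sub>R f) ` {0..}"

text \<open>The product \<open>M r ** M (r+1) ** \<dots> ** M (s-1)\<close>, the identity matrix if \<open>s \<le> r\<close>.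
  The type class multiplication on \<open>real^'n^'n\<close> is componentwise, so the product over
  a list of matrices has to be folded with \<open>**\<close>.\<close>

definition mat_prod :: "(nat \<Rightarrow> real^'n^'n) \<Rightarrow> nat \<Rightarrow> nat \<Rightarrow> real^'n^'n" where
  "mat_prod M r s = foldr (**) (map M [r..<s]) (mat 1)"

definition primitive_seq :: "(nat \<Rightarrow> real^'n^'n) \<Rightarrow> bool" where
  "primitive_seq M \<longleftrightarrow>
     (\<forall>n i j. 0 \<le> M n $ i $ j) \<and>
     (\<forall>r. \<exists>s>r. \<forall>i j. 0 < mat_prod M r s $ i $ j)"

text \<open>The two sets of infinite words over the alphabet \<open>{C1, C2}\<close>:
  \<open>{C1,C2}\<^sup>* {C1\<^sup>\<nat>, C2\<^sup>\<nat>}\<close> and \<open>{C1,C2}\<^sup>* {C1\<^sup>2, C2\<^sup>2}\<^sup>\<nat>\<close>.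
  The number \<open>N\<close> is the length of the finite prefix; in the second set, a square
  \<open>C1\<^sup>2\<close> is a word of length two, not a matrix product.\<close>

definition eventually_constant_words :: "(nat \<Rightarrow> real^3^3) set" where
  "eventually_constant_words =
     {M \<in> UNIV \<rightarrow> {C1, C2}. \<exists>N. (\<forall>n\<ge>N. M n = C1) \<or> (\<forall>n\<ge>N. M n = C2)}"

definition eventually_squares_words :: "(nat \<Rightarrow> real^3^3) set" where
  "eventually_squares_words =
     {M \<in> UNIV \<rightarrow> {C1, C2}. \<exists>N. \<forall>i. M (N + 2 * i) = M (N + 2 * i + 1)}"

text \<open>The reals as a vector space over the rationals.\<close>

global_interpretation rat_vs: vector_space "\<lambda>(q::rat) (x::real). of_rat q * x"
  by unfold_locales (simp_all add: algebra_simps of_rat_add of_rat_mult)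

definition dim_rat :: "real^'n \<Rightarrow> nat" where
  "dim_rat f = rat_vs.dim (rat_vs.span (range (\<lambda>i. f $ i)))"

end

theory Submission
  imports Defs
begin

text \<open>
  Write \<open>f = M\<^sub>0 \<cdots> M\<^sub>n\<^sub>-\<^sub>1 f\<^sub>n\<close> with \<open>f\<^sub>n \<ge> 0\<close>. The entries of \<open>f\<close> and \<open>f\<^sub>n\<close> span the same rational
  space. Passing to \<open>f\<^sub>n\<^sub>+\<^sub>1\<close> lowers the entry sum by the new middle entry, and
  \<open>C1\<^sup>2\<close>, \<open>C2\<^sup>2\<close> fix the middle entry; so along a sequence of squares the middle entry is \<open>0\<close>
  and the dimension is at most 2, while for a rational direction descent on the entry sum makes the
  middle entry eventually \<open>0\<close>, which forces a constant sequence.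

  Tracking the supports of the rows of \<open>M\<^sub>r \<cdots> M\<^sub>n\<^sub>-\<^sub>1\<close> shows that primitivity is the failure of
  being eventually a sequence of squares. Finally, let \<open>l\<close> be a nonzero integer row with
  \<open>l f = 0\<close> and put \<open>l\<^sub>n = l M\<^sub>0 \<cdots> M\<^sub>n\<^sub>-\<^sub>1 = (x, y, z)\<close>. In the primitive case all \<open>l\<^sub>n\<close> have
  entries of both signs, and then
  \<open>max {|x - y|, |y - z|, |x - z|, |x - y + z|}\<close> is nonincreasing in \<open>n\<close>. Being an integer it
  becomes constant, and the way in which the maximum is passed on forces a sequence of squares,
  a contradiction.
\<close>

section \<open>Orbits of row vectors\<close>

text \<open>Here \<open>w n\<close> stands for \<open>M n = C1\<close>: a row orbit satisfies \<open>l\<^sub>n\<^sub>+\<^sub>1 = l\<^sub>n M\<^sub>n\<close> and a column orbit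
  \<open>f\<^sub>n = M\<^sub>n f\<^sub>n\<^sub>+\<^sub>1\<close>.\<close>

definition row_orbit :: "(nat \<Rightarrow> bool) \<Rightarrow> (nat \<Rightarrow> 'a::linordered_idom) \<Rightarrow> (nat \<Rightarrow> 'a) \<Rightarrow> (nat \<Rightarrow> 'a) \<Rightarrow> bool" where
  "row_orbit w x y z \<longleftrightarrow> (\<forall>n. x (Suc n) = (if w n then x n else y n) \<and>
     y (Suc n) = x n + z n \<and> z (Suc n) = (if w n then y n else z n))"

definition col_orbit :: "(nat \<Rightarrow> bool) \<Rightarrow> (nat \<Rightarrow> 'a::linordered_idom) \<Rightarrow> (nat \<Rightarrow> 'a) \<Rightarrow> (nat \<Rightarrow> 'a) \<Rightarrow> bool" where
  "col_orbit w p q r \<longleftrightarrow> (\<forall>n. p n = (if w n then p (Suc n) + q (Suc n) else q (Suc n)) \<and>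
     q n = (if w n then r (Suc n) else p (Suc n)) \<and>
     r n = (if w n then q (Suc n) else q (Suc n) + r (Suc n)))"

definition ev_squares :: "(nat \<Rightarrow> 'a) \<Rightarrow> bool" where
  "ev_squares w \<longleftrightarrow> (\<exists>N. \<forall>i. w (N + 2 * i) = w (N + 2 * i + 1))"

lemma row_orbitD:
  assumes "row_orbit w x y z"
  shows "x (Suc n) = (if w n then x n else y n)" "y (Suc n) = x n + z n"
    "z (Suc n) = (if w n then y n else z n)"
  using assms unfolding row_orbit_def by blast+

text \<open>Reversing the order of the coordinates conjugates \<open>C1\<close> into
  \<open>C2\<close>. With its analogue for columns, this symmetry lets arguments treat one letter
  only.\<close>

lemma row_orbit_flip:
  assumes "row_orbit w x y z"
  shows "row_orbit (\<lambda>n. \<not> w n) z y x"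
  using assms by (auto simp: row_orbit_def)

lemma row_orbit_exists:
  fixes a b c :: "'a::linordered_idom"
  obtains x y z where "row_orbit w x y z" "x 0 = a" "y 0 = b" "z 0 = c"
proof -
  define F where "F = rec_nat (a, b, c)
    (\<lambda>n (x, y, z). (if w n then x else y, x + z, if w n then y else z))"
  have "row_orbit w (\<lambda>n. fst (F n)) (\<lambda>n. fst (snd (F n))) (\<lambda>n. snd (snd (F n)))"
    by (auto simp: row_orbit_def F_def split: prod.splits)
  then show thesis by (rule that) (auto simp: F_def)
qed

lemma not_ev_squares_iff:
  "\<not> ev_squares w \<longleftrightarrow> (\<forall>N. \<exists>i. w (N + 2 * i) \<noteq> w (N + 2 * i + 1))"
  by (auto simp: ev_squares_def)

lemma not_ev_squares_shift:
  assumes "\<not> ev_squares w"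
  shows "\<not> ev_squares (\<lambda>n. w (k + n))"
proof
  assume "ev_squares (\<lambda>n. w (k + n))"
  then obtain N where "\<And>i. w (k + (N + 2 * i)) = w (k + (N + 2 * i + 1))"
    by (auto simp: ev_squares_def)
  then have "\<And>i. w (k + N + 2 * i) = w (k + N + 2 * i + 1)"
    by (simp add: add.assoc)
  then show False
    using assms unfolding ev_squares_def by blast
qed

lemma not_ev_squares_flip:
  assumes "\<not> ev_squares w"
  shows "\<not> ev_squares (\<lambda>n. \<not> w n)"
  using assms unfolding ev_squares_def by blast

text \<open>A letter missing from some index on would leave a constant tail, which consists of
  squares. Applied to the flipped word, this gives recurrence of the other letter.\<close>

lemma not_ev_squares_ex:
  assumes "\<not> ev_squares w"
  shows "\<exists>d. w (n + d)"
proof -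
  obtain i where "w (n + 2 * i) \<noteq> w (n + (2 * i + 1))"
    using assms unfolding not_ev_squares_iff by (metis add.assoc)
  then show ?thesis by blast
qed

section \<open>Positivity of nonnegative row orbits\<close>

context
  fixes w x y and z :: "nat \<Rightarrow> 'a::linordered_idom"
  assumes orb: "row_orbit w x y z"
begin

lemma row_orbit_nonneg:
  assumes "0 \<le> x n" "0 \<le> y n" "0 \<le> z n" "n \<le> m"
  shows "0 \<le> x m \<and> 0 \<le> y m \<and> 0 \<le> z m"
  using \<open>n \<le> m\<close> by (induction m rule: dec_induct) (use assms in \<open>auto simp: row_orbitD[OF orb]\<close>)

lemma row_orbit_pos:
  assumes "0 < x n" "0 < y n" "0 < z n" "n \<le> m"
  shows "0 < x m \<and> 0 < y m \<and> 0 < z m"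
  using \<open>n \<le> m\<close> by (induction m rule: dec_induct) (use assms in \<open>auto simp: row_orbitD[OF orb]\<close>)

text \<open>While \<open>C2\<close> is read, the row becomes \<open>(y, x + z, z)\<close> and its
  first two entries stay positive; the next \<open>C1\<close> turns it into
  \<open>(x, x + z, y)\<close>, where all entries are positive.\<close>

lemma row_orbit_pos_of_12:
  assumes "w (n + d)" "0 < x n" "0 < y n" "0 \<le> z n"
  shows "\<exists>m\<ge>n. 0 < x m \<and> 0 < y m \<and> 0 < z m"
  using assms
proof (induction d arbitrary: n)
  case (0 n)
  then show ?case by (intro exI[of _ "Suc n"]) (auto simp: row_orbitD[OF orb])
next
  case (Suc d n)
  show ?case
  proof (cases "w n")
    case True
    with Suc.prems show ?thesis by (intro exI[of _ "Suc n"]) (auto simp: row_orbitD[OF orb])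
  next
    case False
    with Suc.prems Suc.IH[of "Suc n"] show ?thesis
      by (auto simp: row_orbitD[OF orb] add_pos_nonneg dest: Suc_leD)
  qed
qed

end

text \<open>Blocks of two equal letters keep the middle entry positive. The first block of two
  different letters makes the middle and one outer entry positive, and
  \<open>row_orbit_pos_of_12\<close> or its mirror image finishes.\<close>

lemma row_orbit_pos_of_2:
  fixes z :: "nat \<Rightarrow> 'a::linordered_idom"
  assumes orb: "row_orbit w x y z" and nsq: "\<not> ev_squares w"
    and "0 < y n" "0 \<le> x n" "0 \<le> z n"
  shows "\<exists>m\<ge>n. 0 < x m \<and> 0 < y m \<and> 0 < z m"
proof -
  note D = row_orbitD[OF orb]
  have nonsquare: "\<exists>m\<ge>n. 0 < x m \<and> 0 < y m \<and> 0 < z m"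
    if "w n \<noteq> w (Suc n)" "0 < y n" "0 \<le> x n" "0 \<le> z n" for n
  proof (cases "w n")
    case True
    then have "0 < z (Suc (Suc n))" "0 < y (Suc (Suc n))" "0 \<le> x (Suc (Suc n))"
      using that by (auto simp: D add_nonneg_pos)
    moreover obtain d where "\<not> w (Suc (Suc n) + d)"
      using not_ev_squares_ex[OF not_ev_squares_flip[OF nsq]] by blast
    ultimately show ?thesis
      using row_orbit_pos_of_12[OF row_orbit_flip[OF orb], of "Suc (Suc n)"]
      by (meson Suc_leD)
  next
    case False
    then have "0 < x (Suc (Suc n))" "0 < y (Suc (Suc n))" "0 \<le> z (Suc (Suc n))"
      using that by (auto simp: D add_pos_nonneg)
    moreover obtain d where "w (Suc (Suc n) + d)"
      using not_ev_squares_ex[OF nsq] by blast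
    ultimately show ?thesis
      using row_orbit_pos_of_12[OF orb, of "Suc (Suc n)"]
      by (meson Suc_leD)
  qed
  obtain i where "w (n + 2 * i) \<noteq> w (n + 2 * i + 1)"
    using nsq by (auto simp: not_ev_squares_iff)
  then show ?thesis
    using assms(3-)
  proof (induction i arbitrary: n)
    case (0 n)
    then show ?case using nonsquare by simp
  next
    case (Suc i n)
    show ?case
    proof (cases "w n = w (Suc n)")
      case True
      then have "0 < y (Suc (Suc n))" "0 \<le> x (Suc (Suc n))" "0 \<le> z (Suc (Suc n))"
        using Suc.prems by (auto simp: D add_pos_nonneg add_nonneg_pos)
      with Suc.IH[of "Suc (Suc n)"] Suc.prems(1) show ?thesis
        by (auto dest: Suc_leD)
    next
      case False
      with Suc.prems show ?thesis by (intro nonsquare)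
    qed
  qed
qed

lemma row_orbit_eventually_pos:
  fixes z :: "nat \<Rightarrow> 'a::linordered_idom"
  assumes orb: "row_orbit w x y z" and nsq: "\<not> ev_squares w"
    and nonneg: "0 \<le> x n" "0 \<le> y n" "0 \<le> z n" and nz: "x n \<noteq> 0 \<or> y n \<noteq> 0 \<or> z n \<noteq> 0"
  shows "\<forall>\<^sub>F m in sequentially. 0 < x m \<and> 0 < y m \<and> 0 < z m"
proof -
  have "\<exists>k. 0 < y k \<and> 0 \<le> x k \<and> 0 \<le> z k"
  proof (cases "y n = 0")
    case True
    then have "0 < y (Suc n)"
      using nonneg nz unfolding row_orbitD(2)[OF orb] by linarith
    then show ?thesis
      using row_orbit_nonneg[OF orb nonneg, of "Suc n"] le_SucI[OF order_refl] by blast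
  next
    case False
    then show ?thesis using nonneg by (intro exI[of _ n]) auto
  qed
  then obtain k where "0 < y k" "0 \<le> x k" "0 \<le> z k" by blast
  then obtain m where "0 < x m" "0 < y m" "0 < z m"
    using row_orbit_pos_of_2[OF orb nsq] by blast
  then show ?thesis
    using row_orbit_pos[OF orb, of m] unfolding eventually_sequentially by blast
qed

section \<open>Integer row orbits of mixed sign\<close>

lemma row_orbit_mixed_imp_ev_squares:
  fixes x y z :: "nat \<Rightarrow> int"
  assumes orb: "row_orbit w x y z"
    and pos: "\<And>n. 0 < x n \<or> 0 < y n \<or> 0 < z n"
    and neg: "\<And>n. x n < 0 \<or> y n < 0 \<or> z n < 0"
  shows "ev_squares w"
proof -
  note D = row_orbitD[OF orb]
  define a where "a n = \<bar>x n - y n\<bar>" for n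
  define b where "b n = \<bar>y n - z n\<bar>" for n
  define c where "c n = \<bar>x n - z n\<bar>" for n
  define d where "d n = \<bar>x n - y n + z n\<bar>" for n
  define V where "V n = max (max (a n) (b n)) (max (c n) (d n))" for n
  \<comment> \<open>Each quantity is inherited from \<open>a\<close>, \<open>b\<close> or
    \<open>d\<close>, except for one that becomes the modulus of an outer entry;
    \<open>small\<close> shows that the exception cannot attain the maximum.\<close>
  have step: "a (Suc n) = (if w n then \<bar>z n\<bar> else d n)" "b (Suc n) = (if w n then d n else \<bar>x n\<bar>)"
    "c (Suc n) = (if w n then a n else b n)" "d (Suc n) = (if w n then b n else a n)" for n
    unfolding a_def b_def c_def d_def D by (cases "w n"; simp; linarith)+
  \<comment> \<open>Some entry lies strictly on the other side of 0, and its distance to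
    \<open>x n\<close> exceeds \<open>|x n|\<close>; likewise for \<open>z n\<close>.\<close>
  have "\<bar>x n\<bar> < max (max (a n) (b n)) (c n)" "\<bar>z n\<bar> < max (max (a n) (b n)) (c n)" for n
    using pos[of n] neg[of n] unfolding a_def b_def c_def less_max_iff_disj by smt+
  then have small: "\<bar>x n\<bar> < V n" "\<bar>z n\<bar> < V n" for n
    unfolding V_def by (meson less_le_trans max.mono max.cobounded1 order_refl)+
  have le_V: "a n \<le> V n" "b n \<le> V n" "c n \<le> V n" "d n \<le> V n" for n
    unfolding V_def by (simp_all add: le_max_iff_disj)
  have V_cases: "V n = a n \<or> V n = b n \<or> V n = c n \<or> V n = d n" for n
    unfolding V_def by (simp add: max_def)
  have V_Suc: "V (Suc n) \<le> V n" for n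
    using V_cases[of "Suc n"] small[of n] le_V[of n] by (auto simp: step split: if_splits)
  obtain N where min: "\<And>n. nat (V N) \<le> nat (V n)"
    using ex_has_least_nat[of "\<lambda>_. True" 0 "\<lambda>n. nat (V n)"] by blast
  have N: "V n = V N" if "N \<le> n" for n
  proof -
    have "V n \<le> V N" using V_Suc that by (rule lift_Suc_antimono_le)
    then show ?thesis using min[of n] small(1)[of n] by linarith
  qed
  txt \<open>By \<open>step\<close> and \<open>small\<close>, the value \<open>V N\<close> is attained by \<open>d\<close> two steps later only if \<open>d\<close>
    attains it now and the two letters agree; a value attained by \<open>c\<close> is lost in the next step.\<close>
  have d_back: "d n = V N \<and> w n = w (Suc n)" if "n \<ge> N" "d (Suc (Suc n)) = V N" for n
    using small[of n] N[of n] that by (auto simp: step split: if_splits)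
  \<comment> \<open>A maximum attained by \<open>a\<close> or \<open>b\<close> at
    \<open>n + 2\<close> comes from \<open>d (n + 1)\<close>, and one attained by \<open>c\<close>
    comes from \<open>d n\<close> through \<open>a\<close> or \<open>b\<close> at
    \<open>n + 1\<close>.\<close>
  have recur: "d n = V N \<or> d (Suc n) = V N \<or> d (Suc (Suc n)) = V N" if "n \<ge> N" for n
    using V_cases[of "Suc (Suc n)"] small[of n] small[of "Suc n"] N[of n] N[of "Suc n"]
      N[of "Suc (Suc n)"] that
    by (auto simp: step split: if_splits)
  have down: "d (n + 2 * i) = V N" if "d (n + 2 * j) = V N" "n \<ge> N" "i \<le> j" for n i j
    using that(3,1)
  proof (induction i rule: inc_induct)
    case (step i)
    then show ?case using d_back[of "n + 2 * i"] \<open>n \<ge> N\<close> by simp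
  qed
  have squares: "ev_squares w" if "n \<ge> N" "\<And>i. d (n + 2 * i) = V N" for n
    unfolding ev_squares_def
  proof (intro exI allI)
    show "w (n + 2 * i) = w (n + 2 * i + 1)" for i
      using d_back[of "n + 2 * i"] that(1) that(2)[of "Suc i"] by simp
  qed
  show ?thesis
  proof (rule ccontr)
    assume "\<not> ev_squares w"
    \<comment> \<open>In each parity class \<open>d\<close> misses the maximum once, hence by
      \<open>down\<close> at all later indices of that class. Three consecutive misses then
      contradict \<open>recur\<close>.\<close>
    then obtain i j where ij: "d (N + 2 * i) \<noteq> V N" "d (Suc N + 2 * j) \<noteq> V N"
      using squares[of N] squares[of "Suc N"] by auto
    have "d (N + 2 * (i + j)) \<noteq> V N" "d (N + 2 * Suc (i + j)) \<noteq> V N"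
      using down[of N "i + j" i] down[of N "Suc (i + j)" i] ij(1) by linarith+
    moreover have "d (Suc N + 2 * (i + j)) \<noteq> V N"
      using down[of "Suc N" "i + j" j] ij(2) by linarith
    ultimately show False
      using recur[of "N + 2 * (i + j)"] by simp
  qed
qed

text \<open>Both outer entries vanish at even times, and therefore the middle entry vanishes at odd
  times.\<close>

lemma row_orbit_squares_not_pos:
  fixes z :: "nat \<Rightarrow> 'a::linordered_idom"
  assumes orb: "row_orbit w x y z" and "x 0 = 0" "z 0 = 0"
    and sq: "\<And>i. w (2 * i) = w (2 * i + 1)"
  shows "\<not> (0 < x n \<and> 0 < y n \<and> 0 < z n)"
proof -
  note D = row_orbitD[OF orb]
  have even: "x (2 * i) = 0 \<and> z (2 * i) = 0" for i
  proof (induction i)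
    case (Suc i)
    then show ?case using sq[of i] by (simp add: D)
  qed (use assms in simp)
  show ?thesis
  proof (cases "even n")
    case True
    then show ?thesis using even by (auto elim: evenE)
  next
    case False
    then obtain i where "n = Suc (2 * i)" by (auto elim: oddE)
    then show ?thesis using even[of i] by (simp add: D)
  qed
qed

section \<open>Orbits of column vectors\<close>

lemma col_orbitD:
  assumes "col_orbit w p q r"
  shows "p n = (if w n then p (Suc n) + q (Suc n) else q (Suc n))"
    "q n = (if w n then r (Suc n) else p (Suc n))"
    "r n = (if w n then q (Suc n) else q (Suc n) + r (Suc n))"
  using assms unfolding col_orbit_def by blast+

lemma col_orbit_flip:
  assumes "col_orbit w p q r"
  shows "col_orbit (\<lambda>n. \<not> w n) r q p"
  unfolding col_orbit_def
proof
  show "r n = (if \<not> w n then r (Suc n) + q (Suc n) else q (Suc n)) \<and>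
      q n = (if \<not> w n then p (Suc n) else r (Suc n)) \<and>
      p n = (if \<not> w n then q (Suc n) else q (Suc n) + p (Suc n))" for n
    using col_orbitD[OF assms, of n] by auto
qed

locale nonneg_col_orbit =
  fixes w :: "nat \<Rightarrow> bool" and p q r :: "nat \<Rightarrow> real"
  assumes orb: "col_orbit w p q r"
    and nonneg: "0 \<le> p n" "0 \<le> q n" "0 \<le> r n"
    and nonzero: "p 0 \<noteq> 0 \<or> q 0 \<noteq> 0 \<or> r 0 \<noteq> 0"
begin

lemma flip: "nonneg_col_orbit (\<lambda>n. \<not> w n) r q p"
  using col_orbit_flip[OF orb] nonneg nonzero by unfold_locales auto

lemma nonzero_all: "p n \<noteq> 0 \<or> q n \<noteq> 0 \<or> r n \<noteq> 0"
proof (induction n)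
  case (Suc n)
  then show ?case using col_orbitD[OF orb, of n] by (auto split: if_splits)
qed (rule nonzero)

text \<open>In \<open>C1\<close> and \<open>C2\<close> the outer columns have sum 1 and the middle
  column has sum 2.\<close>

lemma total_Suc: "p n + q n + r n = (p (Suc n) + q (Suc n) + r (Suc n)) + q (Suc n)"
  using col_orbitD[OF orb, of n] by (auto split: if_splits)

text \<open>Each square preserves the middle entry and lowers the entry sum by at least that amount.
  A positive middle entry would make the sum negative after enough squares.\<close>

lemma middle_eq_0:
  assumes sq: "\<And>i. w (N + 2 * i) = w (N + 2 * i + 1)"
  shows "q N = 0"
proof -
  define s where "s n = p n + q n + r n" for n
  have two: "q (Suc (Suc n)) = q n \<and> s (Suc (Suc n)) + q n \<le> s n"
    if "w n = w (Suc n)" for n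
    using that col_orbitD[OF orb, of n] col_orbitD[OF orb, of "Suc n"] nonneg[of "Suc (Suc n)"]
    unfolding s_def by (cases "w n") auto
  have "q (N + 2 * i) = q N \<and> s (N + 2 * i) + real i * q N \<le> s N" for i
  proof (induction i)
    case (Suc i)
    then show ?case using two[of "N + 2 * i"] sq[of i] by (simp add: algebra_simps)
  qed simp
  moreover have "0 \<le> s n" for n
    using nonneg[of n] by (simp add: s_def)
  ultimately have "real i * q N \<le> s N" for i
    by (smt (verit))
  then have "\<not> 0 < q N"
    using reals_Archimedean3[of "q N"] by (meson linorder_not_less)
  then show ?thesis using nonneg(2)[of N] by simp
qed

text \<open>A constant tail is a sequence of squares both from \<open>N\<close> and from
  \<open>Suc N\<close>, so two consecutive middle entries vanish; reading \<open>C1\<close> moves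
  the second one to \<open>r N\<close>.\<close>

lemma const_eq_0:
  assumes "\<And>n. N \<le> n \<Longrightarrow> w n"
  shows "q N = 0" "r N = 0"
  using middle_eq_0[of N] middle_eq_0[of "Suc N"] assms col_orbitD(3)[OF orb, of N] by simp_all

text \<open>Reading \<open>C2\<close> would give \<open>p k = q (Suc k) = 0\<close>, whereas
  \<open>C1\<close> passes a nonzero \<open>p k\<close> on unchanged.\<close>

lemma const_of_left:
  assumes "\<And>n. N \<le> n \<Longrightarrow> q n = 0" "p N \<noteq> 0" "N \<le> n"
  shows "w n"
proof -
  have step: "w k \<and> p (Suc k) = p k" if "N \<le> k" "p k \<noteq> 0" for k
    using that assms(1)[of "Suc k"] col_orbitD(1)[OF orb, of k] by (auto split: if_splits)
  have "p n \<noteq> 0"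
    using \<open>N \<le> n\<close> by (induction n rule: dec_induct) (use step assms(2) in auto)
  then show ?thesis using step assms(3) by blast
qed

lemma eventually_const_of_middle:
  assumes "\<And>n. N \<le> n \<Longrightarrow> q n = 0"
  shows "(\<forall>n\<ge>N. w n) \<or> (\<forall>n\<ge>N. \<not> w n)"
proof (cases "p N = 0")
  case True
  then have "r N \<noteq> 0" using nonzero_all[of N] assms[of N] by simp
  then show ?thesis
    using nonneg_col_orbit.const_of_left[OF flip, of N] assms by blast
next
  case False
  then show ?thesis using const_of_left[of N] assms by blast
qed

text \<open>Both matrices are invertible over the integers, so all columns stay in \<open>t\<close>
  times the integer lattice. The entry sums are then \<open>t\<close> times a nonincreasing sequence
  of nonnegative integers, which stabilizes.\<close>

lemma rational_imp_eventually_const: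
  assumes "0 < t" "p 0 = t * of_int a" "q 0 = t * of_int b" "r 0 = t * of_int c"
  shows "\<exists>N. (\<forall>n\<ge>N. w n) \<or> (\<forall>n\<ge>N. \<not> w n)"
proof -
  have "\<exists>a b c :: int. p n = t * of_int a \<and> q n = t * of_int b \<and> r n = t * of_int c" for n
  proof (induction n)
    case (Suc n)
    then obtain a b c :: int
      where *: "p n = t * of_int a" "q n = t * of_int b" "r n = t * of_int c" by blast
    show ?case
    proof (cases "w n")
      case True
      then have "p (Suc n) = t * of_int (a - c)" "q (Suc n) = t * of_int c" "r (Suc n) = t * of_int b"
        using * col_orbitD[OF orb, of n] by (auto simp: algebra_simps)
      then show ?thesis by blast
    next
      case False
      then have "p (Suc n) = t * of_int b" "q (Suc n) = t * of_int a" "r (Suc n) = t * of_int (c - a)"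
        using * col_orbitD[OF orb, of n] by (auto simp: algebra_simps)
      then show ?thesis by blast
    qed
  qed (use assms in blast)
  then have "\<exists>k::int. p n + q n + r n = t * of_int k" for n
    by (metis distrib_left of_int_add)
  then obtain k :: "nat \<Rightarrow> int" where k: "\<And>n. p n + q n + r n = t * of_int (k n)"
    by metis
  have k_nonneg: "0 \<le> k n" for n
    using k[of n] nonneg[of n] \<open>0 < t\<close>
    by (metis add_nonneg_nonneg of_int_0_le_iff zero_le_mult_iff less_le_not_le)
  have total: "t * of_int (k n) = t * of_int (k (Suc n)) + q (Suc n)" for n
    using total_Suc[of n] by (simp add: k)
  have k_Suc: "k (Suc n) \<le> k n" for n
  proof -
    have "t * of_int (k (Suc n)) \<le> t * of_int (k n)"
      using total[of n] nonneg(2)[of "Suc n"] by linarith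
    then show ?thesis using \<open>0 < t\<close> by simp
  qed
  obtain N where min: "\<And>n. nat (k N) \<le> nat (k n)"
    using ex_has_least_nat[of "\<lambda>_. True" 0 "\<lambda>n. nat (k n)"] by blast
  have N: "k n = k N" if "N \<le> n" for n
  proof -
    have "k n \<le> k N" using k_Suc that by (rule lift_Suc_antimono_le)
    then show ?thesis using min[of n] k_nonneg[of n] by linarith
  qed
  \<comment> \<open>The drop of the sum from \<open>m\<close> to \<open>Suc m\<close> is the middle
    entry at \<open>Suc m\<close>, hence the shift by one.\<close>
  have "q n = 0" if n: "Suc N \<le> n" for n
  proof -
    obtain m where "n = Suc m" using Suc_le_D[OF n] by blast
    with n have "n = Suc m" "N \<le> m" by auto
    then show ?thesis using total[of m] N[of m] N[of n] by simp
  qed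
  then show ?thesis using eventually_const_of_middle by blast
qed

text \<open>The product of the row at \<open>n\<close>, the matrix \<open>M n\<close> and the column
  at \<open>Suc n\<close> can be bracketed in two ways.\<close>

lemma pairing:
  assumes "row_orbit w x y z"
  shows "of_int (x n) * p n + of_int (y n) * q n + of_int (z n) * r n =
    of_int (x 0) * p 0 + of_int (y 0) * q 0 + of_int (z 0) * r 0"
proof (induction n)
  case (Suc n)
  have "of_int (x (Suc n)) * p (Suc n) + of_int (y (Suc n)) * q (Suc n) + of_int (z (Suc n)) * r (Suc n) =
      of_int (x n) * p n + of_int (y n) * q n + of_int (z n) * r n"
    unfolding row_orbitD[OF assms] col_orbitD[OF orb, of n] by (simp add: algebra_simps)
  then show ?case using Suc by simp
qed simp

text \<open>A nonnegative nonzero row would become positive, and a positive row has a positive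
  pairing with a nonzero nonnegative column.\<close>

lemma relation_imp_not_nonneg:
  fixes x y z :: "nat \<Rightarrow> int"
  assumes row: "row_orbit w x y z" and nsq: "\<not> ev_squares w"
    and rel: "of_int (x 0) * p 0 + of_int (y 0) * q 0 + of_int (z 0) * r 0 = 0"
    and nz: "x n \<noteq> 0 \<or> y n \<noteq> 0 \<or> z n \<noteq> 0"
  shows "\<not> (0 \<le> x n \<and> 0 \<le> y n \<and> 0 \<le> z n)"
proof
  assume "0 \<le> x n \<and> 0 \<le> y n \<and> 0 \<le> z n"
  then obtain m where m: "0 < x m" "0 < y m" "0 < z m"
    using eventually_happens'[OF sequentially_bot row_orbit_eventually_pos[OF row nsq _ _ _ nz]] by blast
  then have "0 \<le> of_int (x m) * p m" "0 \<le> of_int (y m) * q m" "0 \<le> of_int (z m) * r m"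
    using nonneg[of m] by simp_all
  moreover have "of_int (x m) * p m + of_int (y m) * q m + of_int (z m) * r m = 0"
    using pairing[OF row, of m] rel by simp
  ultimately have "of_int (x m) * p m = 0" "of_int (y m) * q m = 0" "of_int (z m) * r m = 0"
    by linarith+
  then show False using m nonzero_all[of m] by simp
qed

lemma relation_imp_ev_squares:
  fixes a b c :: int
  assumes rel: "of_int a * p 0 + of_int b * q 0 + of_int c * r 0 = 0"
    and nz: "a \<noteq> 0 \<or> b \<noteq> 0 \<or> c \<noteq> 0"
  shows "ev_squares w"
proof (rule ccontr)
  assume nsq: "\<not> ev_squares w"
  obtain x y z :: "nat \<Rightarrow> int" where row: "row_orbit w x y z" and init: "x 0 = a" "y 0 = b" "z 0 = c"
    by (rule row_orbit_exists)
  \<comment> \<open>The negated orbit satisfies the same relation. Excluding nonnegativity for both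
    orbits leaves entries of both signs at every time.\<close>
  have row': "row_orbit w (\<lambda>n. - x n) (\<lambda>n. - y n) (\<lambda>n. - z n)"
    using row by (auto simp: row_orbit_def)
  have nz': "x n \<noteq> 0 \<or> y n \<noteq> 0 \<or> z n \<noteq> 0" for n
  proof (induction n)
    case (Suc n)
    then show ?case by (auto simp: row_orbitD[OF row])
  qed (use nz init in simp)
  have "\<not> (0 \<le> x n \<and> 0 \<le> y n \<and> 0 \<le> z n)" for n
    using relation_imp_not_nonneg[OF row nsq _ nz'] rel init by simp
  moreover have "\<not> (0 \<le> - x n \<and> 0 \<le> - y n \<and> 0 \<le> - z n)" for n
    using relation_imp_not_nonneg[OF row' nsq, of n] nz'[of n] rel init by simp
  ultimately have "ev_squares w"
    by (intro row_orbit_mixed_imp_ev_squares[OF row]) (metis neg_0_le_iff_le not_le)+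
  with nsq show False by blast
qed

text \<open>The matrices have integer entries. Through this inclusion, any later column bounds the
  dimension from above.\<close>

lemma subset_span: "{p 0, q 0, r 0} \<subseteq> rat_vs.span {p n, q n, r n}"
proof (induction n)
  case 0
  show ?case by (rule rat_vs.span_superset)
next
  case (Suc n)
  let ?S = "{p (Suc n), q (Suc n), r (Suc n)}"
  have "{p n, q n, r n} \<subseteq> rat_vs.span ?S"
    using col_orbitD[OF orb, of n] by (auto intro: rat_vs.span_add rat_vs.span_base)
  then have "rat_vs.span {p n, q n, r n} \<subseteq> rat_vs.span ?S"
    by (simp add: rat_vs.span_minimal)
  with Suc show ?case by blast
qed

end

section \<open>Rational dimension of triples\<close>

lemma rat_common_denominator:
  fixes u v s :: rat
  obtains a b c d :: int where "0 < d"
    "u * of_int d = of_int a" "v * of_int d = of_int b" "s * of_int d = of_int c"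
proof -
  have "\<exists>a d. 0 < d \<and> x * of_int d = of_int a" for x :: rat
  proof (cases x)
    case (Fract a d)
    then show ?thesis by (intro exI[of _ a] exI[of _ d]) (simp add: Fract_of_int_quotient)
  qed
  then obtain a b c d1 d2 d3 :: int where "0 < d1" "0 < d2" "0 < d3"
    "u * of_int d1 = of_int a" "v * of_int d2 = of_int b" "s * of_int d3 = of_int c"
    by meson
  then show thesis
    by (intro that[of "d1 * d2 * d3" "a * d2 * d3" "b * d1 * d3" "c * d1 * d2"])
      (auto simp flip: \<open>u * of_int d1 = of_int a\<close>)
qed

lemma dim_rat_3: "dim_rat (f :: real^3) = rat_vs.dim {f $ 1, f $ 2, f $ 3}"
proof -
  have "range (\<lambda>i. f $ i) = {f $ 1, f $ 2, f $ 3}"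
    by (simp only: UNIV_3 image_insert image_empty)
  then show ?thesis by (simp add: dim_rat_def rat_vs.dim_span)
qed

lemma rat_vs_dim_eq_0D:
  assumes "rat_vs.dim S = 0" "finite S" "x \<in> S"
  shows "x = 0"
proof -
  obtain B where B: "B \<subseteq> S" "S \<subseteq> rat_vs.span B" "card B = rat_vs.dim S"
    by (rule rat_vs.basis_exists)
  then have "B = {}" using assms finite_subset by fastforce
  then show ?thesis using B(2) \<open>x \<in> S\<close> by auto
qed

lemma rat_vs_dim_eq_1D:
  assumes "rat_vs.dim {a, b, c} = 1" "a \<noteq> 0 \<or> b \<noteq> 0 \<or> c \<noteq> 0"
  obtains t and i j k :: int where "0 < t" "a = t * of_int i" "b = t * of_int j" "c = t * of_int k"
proof -
  obtain B where B: "{a, b, c} \<subseteq> rat_vs.span B" "card B = 1"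
    using rat_vs.basis_exists assms(1) by metis
  then obtain e where "B = {e}" by (auto simp: card_1_singleton_iff)
  with B obtain u v s where uvs: "a = of_rat u * e" "b = of_rat v * e" "c = of_rat s * e"
    by (auto simp: rat_vs.span_singleton)
  obtain i j k d :: int where d: "0 < d"
    and "u * of_int d = of_int i" "v * of_int d = of_int j" "s * of_int d = of_int k"
    by (rule rat_common_denominator)
  then have "u = of_int i / of_int d" "v = of_int j / of_int d" "s = of_int k / of_int d"
    by (simp_all add: eq_divide_eq)
  then have uvs': "a = e / of_int d * of_int i" "b = e / of_int d * of_int j" "c = e / of_int d * of_int k"
    unfolding uvs by (simp_all add: of_rat_divide)
  have "e \<noteq> 0" using assms(2) uvs by auto
  \<comment> \<open>The generator \<open>e\<close> may be negative; moving its sign into the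
    integers gives the positive scale used in the descent.\<close>
  show thesis
  proof (cases "0 < e")
    case True
    then show thesis using d uvs' by (intro that[of "e / of_int d" i j k]) auto
  next
    case False
    then show thesis using d uvs' \<open>e \<noteq> 0\<close>
      by (intro that[of "- e / of_int d" "- i" "- j" "- k"]) (auto simp: divide_neg_pos)
  qed
qed

text \<open>Without a rational relation the three numbers are distinct and independent, so the
  dimension is 3. Clearing denominators makes a relation integral.\<close>

lemma rat_vs_dim_neq_3D:
  assumes "rat_vs.dim {a, b, c} \<noteq> 3"
  obtains i j k :: int where "i \<noteq> 0 \<or> j \<noteq> 0 \<or> k \<noteq> 0"
    "of_int i * a + of_int j * b + of_int k * c = 0"
proof -
  have "\<exists>u v s :: rat. (u \<noteq> 0 \<or> v \<noteq> 0 \<or> s \<noteq> 0) \<and> of_rat u * a + of_rat v * b + of_rat s * c = 0"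
  proof (rule ccontr)
    assume contra: "\<not> ?thesis"
    then have no_rel: "u = 0 \<and> v = 0 \<and> s = 0"
      if "of_rat u * a + of_rat v * b + of_rat s * c = 0" for u v s
      using that by blast
    have c: "c \<noteq> 0"
      using no_rel[of 0 0 1] by auto
    have b: "b \<notin> rat_vs.span {c}"
    proof
      assume "b \<in> rat_vs.span {c}"
      then obtain k where "b = of_rat k * c" by (auto simp: rat_vs.span_singleton)
      then show False using no_rel[of 0 1 "- k"] by (simp add: of_rat_minus)
    qed
    have a: "a \<notin> rat_vs.span {b, c}"
    proof
      assume "a \<in> rat_vs.span {b, c}"
      then obtain k m where "a - of_rat k * b = of_rat m * c"
        by (auto simp: rat_vs.span_insert[of b] rat_vs.span_singleton)
      then show False using no_rel[of 1 "- k" "- m"] by (simp add: of_rat_minus)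
    qed
    have "rat_vs.independent {a, b, c}"
      using a b c by (simp add: rat_vs.independent_insert)
    moreover have "card {a, b, c} = 3"
      using a b by (auto simp: card_insert_if rat_vs.span_base)
    ultimately show False
      using assms rat_vs.dim_eq_card_independent by metis
  qed
  then obtain u v s :: rat where uvs: "u \<noteq> 0 \<or> v \<noteq> 0 \<or> s \<noteq> 0"
    "of_rat u * a + of_rat v * b + of_rat s * c = 0" by blast
  obtain i j k d :: int where d: "0 < d"
    and ijk: "u * of_int d = of_int i" "v * of_int d = of_int j" "s * of_int d = of_int k"
    by (rule rat_common_denominator)
  have "(of_int i :: real) = of_rat u * of_int d" "(of_int j :: real) = of_rat v * of_int d"
    "(of_int k :: real) = of_rat s * of_int d"
    using ijk[THEN arg_cong[where f = "of_rat :: rat \<Rightarrow> real"]] by (simp_all add: of_rat_mult)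
  then have "of_int i * a + of_int j * b + of_int k * c
      = of_int d * (of_rat u * a + of_rat v * b + of_rat s * c)"
    by (simp add: algebra_simps)
  moreover have "i \<noteq> 0 \<or> j \<noteq> 0 \<or> k \<noteq> 0"
    using uvs(1) ijk d by auto
  ultimately show thesis
    using uvs(2) by (intro that) simp_all
qed

section \<open>Products of \<open>C1\<close> and \<open>C2\<close>\<close>

lemma matrix_vector_mult_C1: "C1 *v x = vector [x $ 1 + x $ 2, x $ 3, x $ 2]"
  by (simp add: C1_def vec_eq_iff forall_3 matrix_vector_mult_def sum_3)

lemma matrix_vector_mult_C2: "C2 *v x = vector [x $ 2, x $ 1, x $ 2 + x $ 3]"
  by (simp add: C2_def vec_eq_iff forall_3 matrix_vector_mult_def sum_3)

lemma C1_neq_C2: "C1 \<noteq> C2"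
proof
  assume "C1 = C2"
  then have "C1 $ 1 $ 1 = C2 $ 1 $ 1" by simp
  then show False by (simp add: C1_def C2_def)
qed

lemma mat_prod_same: "mat_prod M r r = mat 1"
  by (simp add: mat_prod_def)

lemma mat_prod_Suc:
  assumes "r \<le> n"
  shows "mat_prod M r (Suc n) = mat_prod M r n ** M n"
proof -
  have "foldr (**) xs A = foldr (**) xs (mat 1) ** A" for xs and A :: "real^'n^'n"
    by (induction xs) (simp_all add: matrix_mul_assoc)
  from this[of "map M [r..<n]" "M n"] show ?thesis
    using assms by (simp add: mat_prod_def)
qed

lemma matrix_mult_C1_entries:
  "(A ** C1) $ i $ 1 = A $ i $ 1" "(A ** C1) $ i $ 2 = A $ i $ 1 + A $ i $ 3"
  "(A ** C1) $ i $ 3 = A $ i $ 2"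
  by (simp_all add: C1_def matrix_matrix_mult_def sum_3)

lemma matrix_mult_C2_entries:
  "(A ** C2) $ i $ 1 = A $ i $ 2" "(A ** C2) $ i $ 2 = A $ i $ 1 + A $ i $ 3"
  "(A ** C2) $ i $ 3 = A $ i $ 3"
  by (simp_all add: C2_def matrix_matrix_mult_def sum_3)

text \<open>Time is counted from \<open>r\<close>, where the product is the identity, so the orbit
  starts at the \<open>i\<close>-th unit row.\<close>

lemma mat_prod_row_orbit:
  assumes "M \<in> UNIV \<rightarrow> {C1, C2}"
  shows "row_orbit (\<lambda>n. M (r + n) = C1) (\<lambda>n. mat_prod M r (r + n) $ i $ 1)
    (\<lambda>n. mat_prod M r (r + n) $ i $ 2) (\<lambda>n. mat_prod M r (r + n) $ i $ 3)"
  unfolding row_orbit_def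
proof (intro allI)
  fix n
  have "M (r + n) = C1 \<or> M (r + n) = C2" using assms by auto
  then show "mat_prod M r (r + Suc n) $ i $ 1 =
        (if M (r + n) = C1 then mat_prod M r (r + n) $ i $ 1 else mat_prod M r (r + n) $ i $ 2) \<and>
      mat_prod M r (r + Suc n) $ i $ 2 = mat_prod M r (r + n) $ i $ 1 + mat_prod M r (r + n) $ i $ 3 \<and>
      mat_prod M r (r + Suc n) $ i $ 3 =
        (if M (r + n) = C1 then mat_prod M r (r + n) $ i $ 2 else mat_prod M r (r + n) $ i $ 3)"
    using C1_neq_C2 by (auto simp: mat_prod_Suc matrix_mult_C1_entries matrix_mult_C2_entries)
qed

section \<open>Primitivity in terms of squares\<close>

lemma primitive_seq_iff_not_ev_squares:
  assumes M: "M \<in> UNIV \<rightarrow> {C1, C2}"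
  shows "primitive_seq M \<longleftrightarrow> \<not> ev_squares (\<lambda>n. M n = C1)"
proof
  assume prim: "primitive_seq M"
  show "\<not> ev_squares (\<lambda>n. M n = C1)"
  proof
    assume "ev_squares (\<lambda>n. M n = C1)"
    then obtain N where N: "\<And>i. (M (N + 2 * i) = C1) = (M (N + (2 * i + 1)) = C1)"
      by (auto simp: ev_squares_def)
    obtain s where "s > N" and s: "\<And>i j. 0 < mat_prod M N s $ i $ j"
      using prim unfolding primitive_seq_def by blast
    \<comment> \<open>The second row starts at \<open>(0, 1, 0)\<close>, which never becomes
      positive along squares.\<close>
    have "mat_prod M N (N + 0) $ 2 $ 1 = 0" "mat_prod M N (N + 0) $ 2 $ 3 = 0"
      by (simp_all add: mat_prod_same mat_def)
    from row_orbit_squares_not_pos[OF mat_prod_row_orbit[OF M] this N, of "s - N"] s \<open>s > N\<close>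
    show False by simp
  qed
next
  assume nsq: "\<not> ev_squares (\<lambda>n. M n = C1)"
  have "0 \<le> M n $ i $ j" for n i j
  proof -
    have "M n = C1 \<or> M n = C2" using M by auto
    then show ?thesis using exhaust_3[of i] exhaust_3[of j] by (auto simp: C1_def C2_def)
  qed
  moreover have "\<exists>s>r. \<forall>i j. 0 < mat_prod M r s $ i $ j" for r
  proof -
    have "\<forall>\<^sub>F m in sequentially. \<forall>j. 0 < mat_prod M r (r + m) $ i $ j" for i
    proof -
      have "0 \<le> mat_prod M r (r + 0) $ i $ j" for j
        by (simp add: mat_prod_same mat_def)
      moreover have "mat_prod M r (r + 0) $ i $ 1 \<noteq> 0 \<or> mat_prod M r (r + 0) $ i $ 2 \<noteq> 0
          \<or> mat_prod M r (r + 0) $ i $ 3 \<noteq> 0"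
        using exhaust_3[of i] by (auto simp: mat_prod_same mat_def)
      ultimately show ?thesis
        unfolding forall_3
        by (intro row_orbit_eventually_pos[OF mat_prod_row_orbit[OF M] not_ev_squares_shift[OF nsq]])
    qed
    then have "\<forall>\<^sub>F m in sequentially. \<forall>i j. 0 < mat_prod M r (r + m) $ i $ j"
      by (rule eventually_all_finite)
    \<comment> \<open>The bound \<open>1 \<le> m\<close> ensures that \<open>r + m\<close> exceeds
      \<open>r\<close>.\<close>
    then obtain m where "\<forall>i j. 0 < mat_prod M r (r + m) $ i $ j" "1 \<le> m"
      unfolding eventually_sequentially by (meson nat_le_linear)
    then show ?thesis by (intro exI[of _ "r + m"]) auto
  qed
  ultimately show "primitive_seq M"
    unfolding primitive_seq_def by blast
qed

text \<open>The preimages of \<open>f\<close> under the products are chosen separately for each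
  \<open>n\<close>; injectivity of the products forces them to be linked by
  \<open>M n\<close>.\<close>

lemma inter_cones_orbit:
  fixes M :: "nat \<Rightarrow> real^3^3" and f :: "real^3"
  assumes M: "M \<in> UNIV \<rightarrow> {C1, C2}"
    and f: "f \<in> (\<Inter>n. (\<lambda>x. mat_prod M 0 n *v x) ` nonneg_orthant)" and "f \<noteq> 0"
  obtains p q r where "nonneg_col_orbit (\<lambda>n. M n = C1) p q r"
    "p 0 = f $ 1" "q 0 = f $ 2" "r 0 = f $ 3"
proof -
  have M': "M n = C1 \<or> M n = C2" for n using M by auto
  have inj_M: "inj ((*v) (M n))" for n
    using M'[of n]
    by (auto simp: inj_def matrix_vector_mult_C1 matrix_vector_mult_C2 vec_eq_iff[where 'a = real]
        forall_3)
  have inj: "inj ((*v) (mat_prod M 0 n))" for n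
  proof (induction n)
    case (Suc n)
    have "(*v) (mat_prod M 0 (Suc n)) = (*v) (mat_prod M 0 n) \<circ> (*v) (M n)"
      by (simp add: mat_prod_Suc fun_eq_iff matrix_vector_mul_assoc)
    then show ?case using inj_compose[OF Suc inj_M] by (simp only:)
  qed (simp add: mat_prod_same inj_def)
  from f have "\<forall>n. \<exists>x. x \<in> nonneg_orthant \<and> f = mat_prod M 0 n *v x" by auto
  then obtain g where g: "\<And>n. g n \<in> nonneg_orthant" "\<And>n. f = mat_prod M 0 n *v g n"
    by metis
  have g_Suc: "g n = M n *v g (Suc n)" for n
  proof (rule injD[OF inj])
    show "mat_prod M 0 n *v g n = mat_prod M 0 n *v (M n *v g (Suc n))"
      using g(2)[of n] g(2)[of "Suc n"] by (simp add: mat_prod_Suc matrix_vector_mul_assoc)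
  qed
  have g0: "g 0 = f" using g(2)[of 0] by (simp add: mat_prod_same)
  have "nonneg_col_orbit (\<lambda>n. M n = C1) (\<lambda>n. g n $ 1) (\<lambda>n. g n $ 2) (\<lambda>n. g n $ 3)"
  proof
    show "col_orbit (\<lambda>n. M n = C1) (\<lambda>n. g n $ 1) (\<lambda>n. g n $ 2) (\<lambda>n. g n $ 3)"
      unfolding col_orbit_def
    proof (intro allI)
      show "g n $ 1 = (if M n = C1 then g (Suc n) $ 1 + g (Suc n) $ 2 else g (Suc n) $ 2) \<and>
          g n $ 2 = (if M n = C1 then g (Suc n) $ 3 else g (Suc n) $ 1) \<and>
          g n $ 3 = (if M n = C1 then g (Suc n) $ 2 else g (Suc n) $ 2 + g (Suc n) $ 3)" for n
        using M'[of n] C1_neq_C2 unfolding g_Suc[of n]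
        by (auto simp: matrix_vector_mult_C1 matrix_vector_mult_C2)
    qed
    show "g 0 $ 1 \<noteq> 0 \<or> g 0 $ 2 \<noteq> 0 \<or> g 0 $ 3 \<noteq> 0"
      using \<open>f \<noteq> 0\<close> g0 by (auto simp: vec_eq_iff forall_3)
  qed (use g(1) in \<open>auto simp: nonneg_orthant_def\<close>)
  then show thesis by (rule that) (simp_all add: g0)
qed

section \<open>The three possible dimensions\<close>

theorem theorem5p1:
  fixes M :: "nat \<Rightarrow> real^3^3" and f :: "real^3"
  assumes "M \<in> UNIV \<rightarrow> {C1, C2}"
    and "f \<in> Simplex"
    and "(\<Inter>n. (\<lambda>x. mat_prod M 0 n *v x) ` nonneg_orthant) = ray f"
  shows "(dim_rat f = 1 \<longleftrightarrow> M \<in> eventually_constant_words) \<and>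
         (dim_rat f = 2 \<longleftrightarrow> M \<in> eventually_squares_words - eventually_constant_words) \<and>
         (dim_rat f = 3 \<longleftrightarrow> primitive_seq M)"
proof -
  define w where "w n = (M n = C1)" for n
  have M: "M n = C1 \<or> M n = C2" for n using assms(1) by auto
  have const: "M \<in> eventually_constant_words \<longleftrightarrow> (\<exists>N. (\<forall>n\<ge>N. w n) \<or> (\<forall>n\<ge>N. \<not> w n))"
    using assms(1) M C1_neq_C2 unfolding eventually_constant_words_def w_def by auto metis+
  have w_eq: "M m = M n \<longleftrightarrow> w m = w n" for m n
    using M[of m] M[of n] C1_neq_C2 by (auto simp: w_def)
  have squares: "M \<in> eventually_squares_words \<longleftrightarrow> ev_squares w"
    using assms(1) by (simp add: eventually_squares_words_def ev_squares_def w_eq)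
  have prim: "primitive_seq M \<longleftrightarrow> \<not> ev_squares w"
    using primitive_seq_iff_not_ev_squares[OF assms(1)] unfolding w_def .
  have const_squares: "ev_squares w" if "\<forall>n\<ge>N. w n = b" for N b
    using that by (auto simp: ev_squares_def intro!: exI[of _ N])
  have "f \<noteq> 0" using assms(2) by (auto simp: Simplex_def)
  moreover have "f \<in> ray f" by (auto simp: ray_def intro!: image_eqI[of _ _ 1])
  ultimately obtain p q r where "nonneg_col_orbit w p q r"
    and init: "p 0 = f $ 1" "q 0 = f $ 2" "r 0 = f $ 3"
    using inter_cones_orbit[OF assms(1)] assms(3) unfolding w_def by metis
  then interpret nonneg_col_orbit w p q r by simp
  have dim: "dim_rat f = rat_vs.dim {p 0, q 0, r 0}"
    by (simp add: dim_rat_3 init)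
  have dim_le: "dim_rat f \<le> card B" if "{p n, q n, r n} \<subseteq> rat_vs.span B" "finite B" for n B
  proof -
    have "rat_vs.span {p n, q n, r n} \<subseteq> rat_vs.span B"
      using that(1) by (simp add: rat_vs.span_minimal)
    then show ?thesis
      unfolding dim using subset_span[of n] that(2) by (intro rat_vs.dim_le_card) auto
  qed
  have "dim_rat f \<noteq> 0"
    using rat_vs_dim_eq_0D[of "{p 0, q 0, r 0}"] nonzero unfolding dim by auto
  moreover have "dim_rat f \<le> 3"
    using rat_vs.dim_le_card'[of "{p 0, q 0, r 0}"] card_length[of "[p 0, q 0, r 0]"]
    unfolding dim by simp
  moreover have "dim_rat f \<le> 2" if sq: "ev_squares w"
  proof -
    obtain N where "\<And>i. w (N + 2 * i) = w (N + 2 * i + 1)"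
      using sq by (auto simp: ev_squares_def)
    then have "q N = 0" by (rule middle_eq_0)
    then have "{p N, q N, r N} \<subseteq> rat_vs.span {p N, r N}"
      by (auto intro: rat_vs.span_base rat_vs.span_zero)
    then have "dim_rat f \<le> card {p N, r N}" by (rule dim_le) simp
    also have "\<dots> \<le> 2" using card_length[of "[p N, r N]"] by simp
    finally show ?thesis .
  qed
  moreover have "dim_rat f \<le> 1" if "M \<in> eventually_constant_words"
  proof -
    from that consider N where "\<And>n. N \<le> n \<Longrightarrow> w n" | N where "\<And>n. N \<le> n \<Longrightarrow> \<not> w n"
      unfolding const by blast
    \<comment> \<open>A tail of \<open>C1\<close> leaves only \<open>p N\<close>, a tail of
      \<open>C2\<close> only \<open>r N\<close>.\<close>
    then have "\<exists>N e. {p N, q N, r N} \<subseteq> {e, 0}"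
    proof cases
      case 1
      then show ?thesis using const_eq_0 by blast
    next
      case 2
      then show ?thesis using nonneg_col_orbit.const_eq_0[OF flip] by blast
    qed
    then obtain N e where "{p N, q N, r N} \<subseteq> {e, 0}" by blast
    also have "\<dots> \<subseteq> rat_vs.span {e}"
      by (auto intro: rat_vs.span_base rat_vs.span_zero)
    finally show ?thesis using dim_le[of N "{e}"] by simp
  qed
  moreover have "M \<in> eventually_constant_words" if dim1: "dim_rat f = 1"
  proof -
    obtain t and i j k :: int where "0 < t" "p 0 = t * of_int i" "q 0 = t * of_int j" "r 0 = t * of_int k"
      using rat_vs_dim_eq_1D[of "p 0" "q 0" "r 0"] dim1 nonzero unfolding dim by metis
    then show ?thesis unfolding const by (rule rational_imp_eventually_const)
  qed
  moreover have "ev_squares w" if dim3: "dim_rat f \<noteq> 3"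
  proof -
    obtain i j k :: int where "i \<noteq> 0 \<or> j \<noteq> 0 \<or> k \<noteq> 0"
      "of_int i * p 0 + of_int j * q 0 + of_int k * r 0 = 0"
      using rat_vs_dim_neq_3D[of "p 0" "q 0" "r 0"] dim3 unfolding dim by metis
    then show ?thesis by (intro relation_imp_ev_squares)
  qed
  moreover have "ev_squares w" if "M \<in> eventually_constant_words"
    using that const_squares unfolding const by blast
  \<comment> \<open>The dimension lies between 1 and 3; it is 1 exactly for eventually constant
    words and at most 2 exactly for eventual squares.\<close>
  ultimately show ?thesis
    unfolding Diff_iff squares prim by linarith
qed

end
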